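(* Let $a, b, c, d, f, g$ be rational numbers with $c > 0$ and $g > 0$, and let $m$ and $n$ be natural numbers greater than $1$. Suppose that both $\sqrt[m]{c}$ and $\sqrt[n]{g}$ are irreducible and that $a + b\sqrt[m]{c} = d + f\sqrt[n]{g}$. Then $m = n$, $a = d$, and $b\sqrt[n]{c} = f\sqrt[n]{g}$.
   Context: Natural numbers are the positive integers, and $\sqrt[n]{A}$ denotes the positive real $n$-th root. For a positive rational number $A$ and a natural number $n \ge 2$, the radical $\sqrt[n]{A}$ is called irreducible if there do not exist a natural number $m < n$ (with $m=1$ allowed, $\sqrt[1]{B}=B$) and a positive rational number $B$ such that $\sqrt[n]{A} = \sqrt[m]{B}$.
   Formalization: The formal theorem additionally assumes that b and f are not both zero; without this the claim m = n fails, e.g. for a = b = d = f = 0, c = g = 2, m = 2, n = 3. *)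

theory Defs
  imports "HOL-Analysis.Analysis"
begin

(* Irreducibility of the radical root n A, as a predicate on the index n and the radicand A.
   The exponent m ranges over positive naturals: root 0 B = 0 is a junk value. Intended for
   n >= 2 and positive rational A. *)
definition irreducible_radical :: "nat \<Rightarrow> real \<Rightarrow> bool" where
  "irreducible_radical n A \<longleftrightarrow>
     \<not> (\<exists>m B. 0 < m \<and> m < n \<and> B \<in> \<rat> \<and> 0 < B \<and> root n A = root m B)"

end

(* Every complex root of X^m - c has modulus root m c, so a rational factor of X^m - c of
   degree k makes (root m c)^k rational, being the modulus of a rational constant term.
   Irreducibility of the radical therefore says that root m c has degree m over the rationals.
   If root m c = p + q * root n g with p, q rational and q nonzero, then both radicals have the
   same degree, so m = n and the polynomials (p + q X)^m - c and q^m (X^m - g) agree;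
   comparing their derivatives at 0 gives p = 0. *)
theory Submission
  imports Defs "HOL-Computational_Algebra.Fundamental_Theorem_Algebra"
    "HOL-Computational_Algebra.Polynomial_Factorial"
    "HOL-Computational_Algebra.Field_as_Ring"
begin

lemma of_real_of_rat:
  "of_real (of_rat x) = (of_rat x :: 'a::{real_field,field_char_0})"
  by (cases x) (simp add: of_rat_rat)

text \<open>Extension of coefficients is compatible with the ring operations, so Bezout identities
  and factorizations over the rationals carry over to complex polynomials, where all roots are
  available.\<close>

lemma map_poly_of_rat_add:
  "map_poly of_rat (p + q) = (map_poly of_rat p + map_poly of_rat q :: 'a::field_char_0 poly)"
  by (intro poly_eqI) (simp add: coeff_map_poly of_rat_add)

lemma map_poly_of_rat_diff:
  "map_poly of_rat (p - q) = (map_poly of_rat p - map_poly of_rat q :: 'a::field_char_0 poly)"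
  by (intro poly_eqI) (simp add: coeff_map_poly of_rat_diff)

lemma map_poly_of_rat_mult:
  "map_poly of_rat (p * q) = (map_poly of_rat p * map_poly of_rat q :: 'a::field_char_0 poly)"
  by (intro poly_eqI) (simp add: coeff_map_poly coeff_mult of_rat_mult of_rat_sum)

lemma map_poly_of_rat_power:
  "map_poly of_rat (p ^ k) = (map_poly of_rat p ^ k :: 'a::field_char_0 poly)"
  by (induction k) (simp_all add: map_poly_of_rat_mult)

text \<open>Over the complex numbers \<open>p\<close> splits, so up to sign its constant term is the
  leading coefficient times the product of the roots with multiplicity, and each of the
  \<open>degree p\<close> factors has modulus \<open>r\<close>.\<close>

lemma norm_poly_0_of_roots_norm_eq:
  fixes p :: "complex poly"
  assumes "p \<noteq> 0" and roots: "\<And>z. poly p z = 0 \<Longrightarrow> norm z = r"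
  shows "norm (poly p 0) = norm (lead_coeff p) * r ^ degree p"
proof -
  obtain A where A: "size A = degree p" "p = smult (lead_coeff p) (\<Prod>x\<in>#A. [:-x, 1:])"
    using alg_closed_imp_factorization[OF \<open>p \<noteq> 0\<close>] by blast
  have eval: "poly p z = lead_coeff p * (\<Prod>x\<in>#A. z - x)" for z
    by (subst A(2)) (simp add: poly_prod_mset)
  have "norm x = r" if "x \<in># A" for x
    using that by (intro roots) (auto simp: eval)
  then have "norm (\<Prod>x\<in>#A. 0 - x) = r ^ size A"
    by (induction A) (auto simp: norm_mult)
  then show ?thesis
    using A(1) eval[of 0] by (simp add: norm_mult)
qed

text \<open>A rational polynomial of smaller degree vanishing at the radical would share with X^m -
  C a nonconstant rational factor. The constant term of this factor then yields a radical of smaller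
  index with the same value.\<close>

lemma irreducible_radical_degree_le:
  fixes P :: "rat poly"
  assumes irr: "irreducible_radical m (of_rat C)" and "C > 0" and "m > 0" and "P \<noteq> 0"
    and root: "poly (map_poly of_rat P) (complex_of_real (root m (of_rat C))) = 0"
  shows "m \<le> degree P"
proof (rule ccontr)
  assume "\<not> m \<le> degree P"
  define \<alpha> where "\<alpha> = root m (of_rat C)"
  have pos: "\<alpha> > 0" and pow: "\<alpha> ^ m = of_rat C"
    using \<open>C > 0\<close> \<open>m > 0\<close> by (simp_all add: \<alpha>_def)
  define R where "R = monom 1 m - [:C:]"
  \<comment> \<open>By Bezout, \<open>D\<close> still vanishes at \<alpha>; since it divides
    \<open>R\<close>, all its complex roots have modulus \<alpha>.\<close>
  define D where "D = gcd P R"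
  let ?h = "map_poly of_rat :: rat poly \<Rightarrow> complex poly"
  have evR: "poly (?h R) z = z ^ m - of_rat C" for z
    by (simp add: R_def map_poly_of_rat_diff map_poly_monom map_poly_pCons poly_monom)
  have "D \<noteq> 0" using \<open>P \<noteq> 0\<close> by (simp add: D_def)
  have "complex_of_real \<alpha> ^ m = of_rat C"
    by (metis pow of_real_of_rat of_real_power)
  then have rootR: "poly (?h R) (of_real \<alpha>) = 0" by (simp add: evR)
  obtain u v where "u * P + v * R = D"
    using bezout_coefficients_fst_snd[of P R] unfolding D_def by blast
  then have "?h D = ?h u * ?h P + ?h v * ?h R"
    by (metis map_poly_of_rat_add map_poly_of_rat_mult)
  then have rootD: "poly (?h D) (of_real \<alpha>) = 0"
    using root rootR by (simp add: \<alpha>_def)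
  have degD: "degree (?h D) = degree D" by (simp add: degree_map_poly)
  have "degree D \<noteq> 0"
  proof
    assume "degree D = 0"
    then obtain a where "D = [:a:]" by (rule degree_eq_zeroE)
    then show False using rootD \<open>D \<noteq> 0\<close> by (simp add: map_poly_pCons)
  qed
  have "degree D \<le> degree P"
    using \<open>P \<noteq> 0\<close> by (intro dvd_imp_degree_le) (simp_all add: D_def)
  have "D dvd R" by (simp add: D_def)
  then obtain E where "R = D * E" by (rule dvdE)
  then have "?h R = ?h D * ?h E" by (simp add: map_poly_of_rat_mult)
  then have norm_root: "norm z = \<alpha>" if "poly (?h D) z = 0" for z
  proof -
    have "z ^ m = complex_of_real \<alpha> ^ m"
      using that \<open>?h R = _\<close> evR[of z] evR[of "of_real \<alpha>"] rootR by simp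
    then have "norm z ^ m = \<alpha> ^ m"
      using pos by (metis norm_of_real norm_power abs_of_pos)
    then show ?thesis using pos \<open>m > 0\<close> by (simp add: power_eq_iff_eq_base)
  qed
  have norm_of_rat: "norm (of_rat x :: complex) = of_rat \<bar>x\<bar>" for x
    unfolding of_real_of_rat[where 'a = complex, symmetric] norm_of_real
    by (simp add: abs_if of_rat_minus)
  \<comment> \<open>\<open>B\<close> is the absolute value of the constant term of \<open>D\<close>
    made monic, hence the product of the moduli of its roots. It is the radicand that contradicts
    irreducibility, with index \<open>degree D\<close>.\<close>
  define B where "B = \<bar>coeff D 0\<bar> / \<bar>lead_coeff D\<bar>"
  have "?h D \<noteq> 0" using \<open>D \<noteq> 0\<close> by (simp add: map_poly_eq_0_iff)
  from norm_poly_0_of_roots_norm_eq[OF this norm_root]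
  have "of_rat \<bar>coeff D 0\<bar> = of_rat \<bar>lead_coeff D\<bar> * \<alpha> ^ degree D"
    by (simp add: poly_0_coeff_0 coeff_map_poly degD norm_of_rat)
  then have B: "\<alpha> ^ degree D = of_rat B"
    using \<open>D \<noteq> 0\<close> by (simp add: B_def of_rat_divide field_simps)
  have "root m (of_rat C) = root (degree D) (of_rat B)"
    using \<open>degree D \<noteq> 0\<close> pos real_root_power_cancel[of "degree D" \<alpha>]
    unfolding B[symmetric] by (simp add: \<alpha>_def)
  moreover have "(of_rat B :: real) > 0" using B pos by (metis zero_less_power)
  ultimately show False
    using irr \<open>degree D \<noteq> 0\<close> \<open>degree D \<le> degree P\<close> \<open>\<not> m \<le> degree P\<close>
    unfolding irreducible_radical_def by (metis Rats_of_rat le_less_trans not_le gr0I)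
qed

text \<open>A positive rational value is itself a radical of index 1, which irreducibility forbids
  as soon as \<open>m > 1\<close>.\<close>

lemma irreducible_radical_not_Rats:
  assumes "irreducible_radical m c" and "m > 1" and "c > 0"
  shows "root m c \<notin> \<rat>"
proof
  assume "root m c \<in> \<rat>"
  moreover have "root m c > 0" using assms by simp
  ultimately show False
    using assms unfolding irreducible_radical_def by (metis One_nat_def real_root_Suc_0 zero_less_one)
qed

text \<open>Raising the relation to the power \<open>m\<close> shows that (p + q X)^m - C, of degree
  exactly \<open>m\<close> because \<open>q\<close> is nonzero, vanishes at the second radical; the
  degree bound applies to it.\<close>

lemma irreducible_radical_affine_index_le:
  fixes C G p q :: rat
  assumes "C > 0" "G > 0" "m > 0" "n > 0" "q \<noteq> 0"
    and irr: "irreducible_radical n (of_rat G)"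
    and eq: "root m (of_rat C) = of_rat p + of_rat q * root n (of_rat G)"
  shows "poly (map_poly of_rat ([:p, q:] ^ m - [:C:])) (complex_of_real (root n (of_rat G))) = 0"
    and "n \<le> m"
proof -
  let ?P = "[:p, q:] ^ m - [:C:]" and ?\<beta> = "complex_of_real (root n (of_rat G))"
  have "degree ([:p, q:] ^ m) = m"
    using \<open>q \<noteq> 0\<close> by (simp add: degree_power_eq)
  then have deg: "degree ?P = m"
    using \<open>m > 0\<close> by (metis degree_add_eq_left degree_minus degree_pCons_0 uminus_add_conv_diff add.commute)
  have "of_rat p + ?\<beta> * of_rat q = complex_of_real (root m (of_rat C))"
    unfolding eq by (simp add: of_real_of_rat mult.commute)
  moreover have "complex_of_real (root m (of_rat C)) ^ m = of_rat C"
    using \<open>C > 0\<close> \<open>m > 0\<close>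
    by (metis less_imp_le of_real_of_rat of_real_power real_root_pow_pos2 zero_le_of_rat_iff)
  ultimately show zero: "poly (map_poly of_rat ?P) ?\<beta> = 0"
    by (simp add: map_poly_of_rat_diff map_poly_of_rat_power map_poly_pCons)
  have "?P \<noteq> 0" using deg \<open>m > 0\<close> by (metis degree_0 less_irrefl)
  then show "n \<le> m"
    using irreducible_radical_degree_le[OF irr \<open>G > 0\<close> \<open>n > 0\<close> _ zero] deg by simp
qed

text \<open>The coefficients of X must agree: the left side has m p^(m-1) q, the right side 0 since
  \<open>m > 1\<close>.\<close>

lemma affine_power_eq_imp_zero:
  fixes p q C G :: rat
  assumes "m > 1" "q \<noteq> 0" and eq: "[:p, q:] ^ m - [:C:] = smult (q ^ m) (monom 1 m - [:G:])"
  shows "p = 0"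
proof -
  have "poly (pderiv ([:p, q:] ^ m - [:C:])) 0 = of_nat m * p ^ (m - 1) * q"
    by (simp add: pderiv_diff pderiv_power pderiv_pCons)
  moreover have "poly (pderiv (smult (q ^ m) (monom 1 m - [:G:]))) 0 = 0"
    using \<open>m > 1\<close> by (simp add: pderiv_diff pderiv_smult pderiv_monom pderiv_pCons poly_monom)
  ultimately show ?thesis using assms by simp
qed

lemma irreducible_radical_affine:
  fixes C G p q :: rat
  assumes "C > 0" "G > 0" "m > 1" "n > 1" "q \<noteq> 0"
    and irr: "irreducible_radical m (of_rat C)" "irreducible_radical n (of_rat G)"
    and eq: "root m (of_rat C) = of_rat p + of_rat q * root n (of_rat G)"
  shows "m = n \<and> p = 0"
proof -
  have "m > 0" "n > 0" using assms by simp_all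
  note aff = irreducible_radical_affine_index_le
    [OF \<open>C > 0\<close> \<open>G > 0\<close> \<open>m > 0\<close> \<open>n > 0\<close> \<open>q \<noteq> 0\<close> irr(2) eq]
  \<comment> \<open>Solving for the other radical gives a relation of the same shape, so the index
    bound also holds with the roles exchanged.\<close>
  have "root n (of_rat G) = of_rat (- p / q) + of_rat (1 / q) * root m (of_rat C)"
    using \<open>q \<noteq> 0\<close>
    by (simp add: eq of_rat_divide of_rat_minus distrib_left)
  from irreducible_radical_affine_index_le(2)
    [OF \<open>G > 0\<close> \<open>C > 0\<close> \<open>n > 0\<close> \<open>m > 0\<close> _ irr(1) this]
  have "m \<le> n" using \<open>q \<noteq> 0\<close> by simp
  with aff(2) have "m = n" by simp
  let ?\<beta> = "complex_of_real (root m (of_rat G))"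
  \<comment> \<open>Both polynomials vanish at the radical, and the factor \<open>q ^ m\<close>
    makes their leading terms cancel. The difference has degree below \<open>m\<close>, so the
    degree bound forces it to be zero.\<close>
  define Q where "Q = [:p, q:] ^ m - [:C:] - smult (q ^ m) (monom 1 m - [:G:])"
  have "?\<beta> ^ m = of_rat G"
    using \<open>G > 0\<close> \<open>m > 0\<close>
    by (metis less_imp_le of_real_of_rat of_real_power real_root_pow_pos2 zero_le_of_rat_iff)
  then have "poly (map_poly of_rat (smult (q ^ m) (monom 1 m - [:G:]))) ?\<beta> = 0"
    by (simp add: map_poly_smult map_poly_of_rat_diff map_poly_monom map_poly_pCons poly_monom
        of_rat_mult)
  with aff(1) have zero: "poly (map_poly of_rat Q) ?\<beta> = 0"
    unfolding Q_def \<open>m = n\<close> map_poly_of_rat_diff by simp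
  have "coeff ([:p, q:] ^ m) m = q ^ m"
    using lead_coeff_power[of "[:p, q:]" m] \<open>q \<noteq> 0\<close> by (simp add: degree_power_eq)
  then have "coeff Q m = 0"
    using \<open>m > 1\<close> by (simp add: Q_def coeff_pCons split: nat.split)
  moreover have "degree Q \<le> m"
    unfolding Q_def using \<open>m > 1\<close>
    by (intro degree_diff_le order.trans[OF degree_smult_le] degree_monom_le)
      (simp_all add: degree_power_eq \<open>q \<noteq> 0\<close>)
  ultimately have "Q = 0 \<or> degree Q < m"
    by (metis le_neq_implies_less leading_coeff_0_iff)
  then have "Q = 0"
    using irreducible_radical_degree_le[of m G Q] irr(2) \<open>G > 0\<close> \<open>m > 1\<close> \<open>m = n\<close> zero by force
  then show ?thesis
    using affine_power_eq_imp_zero[OF \<open>m > 1\<close> \<open>q \<noteq> 0\<close>, of p C G] \<open>m = n\<close> by (simp add: Q_def)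
qed

text \<open>The condition \<open>b \<noteq> 0 \<or> f \<noteq> 0\<close> excludes the degenerate
  relation \<open>a = d\<close>, which says nothing about the indices.\<close>

theorem mainTheorem2:
  fixes a b c d f g :: real and m n :: nat
  assumes "a \<in> \<rat>" and "b \<in> \<rat>" and "c \<in> \<rat>" and "d \<in> \<rat>" and "f \<in> \<rat>" and "g \<in> \<rat>"
    and "c > 0" and "g > 0"
    and "m > 1" and "n > 1"
    and "irreducible_radical m c" and "irreducible_radical n g"
    and "a + b * root m c = d + f * root n g"
    and "b \<noteq> 0 \<or> f \<noteq> 0"
  shows "m = n \<and> a = d \<and> b * root n c = f * root n g"
proof -
  have irrat: "root m c \<notin> \<rat>" "root n g \<notin> \<rat>"
    using assms irreducible_radical_not_Rats by blast+
  \<comment> \<open>If one of \<open>b\<close> and \<open>f\<close> vanishes, the other does not,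
    and the relation makes its radical rational.\<close>
  have "b \<noteq> 0"
  proof
    assume "b = 0"
    then have "root n g = (a - d) / f" using assms by (simp add: field_simps)
    then show False using irrat assms by simp
  qed
  have "f \<noteq> 0"
  proof
    assume "f = 0"
    then have "root m c = (d - a) / b" using assms by (simp add: field_simps)
    then show False using irrat assms by simp
  qed
  obtain C G where CG: "c = of_rat C" "g = of_rat G"
    using assms by (meson Rats_cases)
  have "(d - a) / b \<in> \<rat>" "f / b \<in> \<rat>" using assms by simp_all
  then obtain p q where pq: "(d - a) / b = of_rat p" "f / b = of_rat q"
    by (meson Rats_cases)
  have "root m c = (d - a) / b + f / b * root n g"
    using \<open>b \<noteq> 0\<close> \<open>a + b * root m c = d + f * root n g\<close>
    by (simp add: add_divide_distrib[symmetric] nonzero_eq_divide_eq algebra_simps)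
  moreover have "q \<noteq> 0" using pq \<open>b \<noteq> 0\<close> \<open>f \<noteq> 0\<close> by auto
  ultimately have "m = n \<and> p = 0"
    using irreducible_radical_affine[of C G m n q p] assms unfolding pq CG by simp
  \<comment> \<open>\<open>p = 0\<close> means \<open>d = a\<close>, and cancelling \<open>a\<close>
    in the original relation leaves the equality of the radical terms.\<close>
  then show ?thesis using pq \<open>b \<noteq> 0\<close> assms by simp
qed

end
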